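(* Let $d\ge1$, let $\mathcal{K}_{\mathrm{rtdet}}\subset\mathbb{R}\times\mathbb{S}^d$ be the root-determinant cone with barrier $F$, and let $G^\ast$ be its conjugate gradient (all defined in the context). Let $(p,R)\in\operatorname{int}(\mathcal{K}_{\mathrm{rtdet}}^\ast)$ and let $R=U_R\operatorname{Diag}(\lambda_R)U_R^\top$ be the eigendecomposition of $R$. Then the components of $G^\ast=G^\ast(p,R)$ are $$G^\ast_p=g^\ast_p(p,\lambda_R)=-p^{-1}-\Bigl(\det(R)^{1/d}+\frac pd\Bigr)^{-1},$$ $$G^\ast_R=U_R\operatorname{Diag}(g^\ast_r(p,\lambda_R))U_R^\top=-\frac{\det(R)^{1/d}}{\det(R)^{1/d}+\frac pd}R^{-1},$$ where $g^\ast$ is the conjugate gradient of the hypograph geometric mean cone $\mathcal{K}_{\mathrm{hgeom}}\subset\mathbb{R}\times\mathbb{R}^d$ with its barrier $f$.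
   Context: For a closed, convex, pointed, full-dimensional cone $\mathcal{K}$ in a finite-dimensional real inner product space, the dual cone is $\mathcal{K}^\ast=\{s:\langle w,s\rangle\ge 0\ \forall w\in\mathcal{K}\}$. Given a barrier function $f:\operatorname{int}(\mathcal{K})\to\mathbb{R}$, the conjugate barrier is $f^\ast(s)=\sup_{w\in\operatorname{int}(\mathcal{K})}\{-\langle s,w\rangle-f(w)\}$ for $s\in\operatorname{int}(\mathcal{K}^\ast)$, and the conjugate gradient $g^\ast$ is the gradient of $f^\ast$; equivalently $g^\ast(s)=-\operatorname{argsup}_{w\in\operatorname{int}(\mathcal{K})}\{-\langle s,w\rangle-f(w)\}$. The standard (trace, for matrices) inner product is used. Let $\varphi(w)=\prod_{i=1}^d w_i^{1/d}$. The hypograph geometric mean cone is $\mathcal{K}_{\mathrm{hgeom}}=\{(u,w)\in\mathbb{R}\times\mathbb{R}^d_+:u\le\varphi(w)\}$ with barrier $f(u,w)=-\log(\varphi(w)-u)-\sum_{i=1}^d\log(w_i)$; the components of its conjugate gradient at $(p,r)$ are $g^\ast_p$ and $g^\ast_r$. $\mathbb{S}^d$ denotes the symmetric $d\times d$ matrices and $\mathbb{S}^d_+$ the positive semidefinite ones. The root-determinant cone is $\mathcal{K}_{\mathrm{rtdet}}=\{(u,W)\in\mathbb{R}\times\mathbb{S}^d_+:u\le\det(W)^{1/d}\}$, with dual $\mathcal{K}_{\mathrm{rtdet}}^\ast=\{(p,R)\in\mathbb{R}_-\times\mathbb{S}^d_+:-p\le d\det(R)^{1/d}\}$ ($\mathbb{R}_-$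 the nonpositive reals), and barrier $F(u,W)=f(u,\lambda_W)=-\log(\varphi(\lambda_W)-u)-\sum_{i=1}^d\log(\lambda_{W,i})$, where $\lambda_W$ is the vector of eigenvalues of $W$. In the eigendecomposition of $R$, $U_R$ is orthogonal and $\lambda_R\in\mathbb{R}^d$ is the vector of eigenvalues. *)

theory Defs
  imports "HOL-Analysis.Analysis"
begin

section \<open>Conjugate barriers and their gradients\<close>

text \<open>
  The finite-dimensional inner product space in which a cone lives is a linear subspace \<open>V\<close> of a
  Euclidean space, with the inherited inner product; this covers \<open>\<real> \<times> \<real>\<^sup>d\<close> (with \<open>V = UNIV\<close>) as well
  as \<open>\<real> \<times> S\<^sup>d\<close> (inside \<open>\<real> \<times> \<real>\<^sup>d\<^sup>\<times>\<^sup>d\<close>). Interiors, duals and gradients are all taken with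
  respect to \<open>V\<close>.
\<close>

definition interior_in :: "'a::euclidean_space set \<Rightarrow> 'a set \<Rightarrow> 'a set" where
  "interior_in V K = top_of_set V interior_of K"

definition dual_cone :: "'a::euclidean_space set \<Rightarrow> 'a set \<Rightarrow> 'a set" where
  "dual_cone V K = {s \<in> V. \<forall>w\<in>K. inner w s \<ge> 0}"

text \<open>
  The supremum is a real one, so \<open>conj_barrier V K f s\<close> is meaningful only where it is finite, as
  it is for \<open>s\<close> in \<open>interior_in V (dual_cone V K)\<close>.
\<close>

definition conj_barrier ::
  "'a::euclidean_space set \<Rightarrow> 'a set \<Rightarrow> ('a \<Rightarrow> real) \<Rightarrow> 'a \<Rightarrow> real" where
  "conj_barrier V K f s = (SUP w\<in>interior_in V K. - inner s w - f w)"

text \<open>For \<open>V = UNIV\<close> this is the vector \<open>g\<close> with \<open>GDERIV h s :> g\<close>.\<close>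

definition gradient_in ::
  "'a::euclidean_space set \<Rightarrow> ('a \<Rightarrow> real) \<Rightarrow> 'a \<Rightarrow> 'a" where
  "gradient_in V h s =
     (THE g. g \<in> V \<and> (h has_derivative (\<lambda>x. inner x g)) (at s within V))"

definition conj_gradient ::
  "'a::euclidean_space set \<Rightarrow> 'a set \<Rightarrow> ('a \<Rightarrow> real) \<Rightarrow> 'a \<Rightarrow> 'a" where
  "conj_gradient V K f = gradient_in V (conj_barrier V K f)"


section \<open>The hypograph geometric mean cone\<close>

definition geom_mean :: "real ^ 'n \<Rightarrow> real" where
  "geom_mean w = (\<Prod>i\<in>UNIV. (w $ i) powr (1 / real CARD('n)))"

definition hgeom_cone :: "(real \<times> (real ^ 'n)) set" where
  "hgeom_cone = {(u, w). (\<forall>i. 0 \<le> w $ i) \<and> u \<le> geom_mean w}"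

definition hgeom_barrier :: "real \<times> (real ^ 'n) \<Rightarrow> real" where
  "hgeom_barrier = (\<lambda>(u, w). - ln (geom_mean w - u) - (\<Sum>i\<in>UNIV. ln (w $ i)))"

definition hgeom_conj_gradient :: "real \<times> (real ^ 'n) \<Rightarrow> real \<times> (real ^ 'n)" where
  "hgeom_conj_gradient = conj_gradient UNIV hgeom_cone hgeom_barrier"


section \<open>The root-determinant cone\<close>

definition sym_mats :: "(real ^ 'n ^ 'n) set" where
  "sym_mats = {W. transpose W = W}"

definition psd_mats :: "(real ^ 'n ^ 'n) set" where
  "psd_mats = {W \<in> sym_mats. \<forall>x. 0 \<le> inner x (W *v x)}"

definition Diag :: "real ^ 'n \<Rightarrow> real ^ 'n ^ 'n" where
  "Diag v = (\<chi> i j. if i = j then v $ i else 0)"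

text \<open>
  The columns of \<open>U\<close> are orthonormal eigenvectors of \<open>W\<close>, and \<open>l\<close> lists the corresponding
  eigenvalues, with multiplicity.
\<close>

definition eigendecomposition ::
  "real ^ 'n ^ 'n \<Rightarrow> real ^ 'n ^ 'n \<Rightarrow> real ^ 'n \<Rightarrow> bool" where
  "eigendecomposition W U l \<longleftrightarrow> orthogonal_matrix U \<and> W = U ** Diag l ** transpose U"

text \<open>
  For symmetric \<open>W\<close> the vector of eigenvalues is determined up to the order of its entries. The
  choice of an order is immaterial, because \<open>hgeom_barrier\<close> is symmetric in the entries of \<open>w\<close>.
\<close>

definition eigenvalues :: "real ^ 'n ^ 'n \<Rightarrow> real ^ 'n" where
  "eigenvalues W = (SOME l. \<exists>U. eigendecomposition W U l)"

definition rtdet_space :: "(real \<times> (real ^ 'n ^ 'n)) set" where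
  "rtdet_space = UNIV \<times> sym_mats"

definition rtdet_cone :: "(real \<times> (real ^ 'n ^ 'n)) set" where
  "rtdet_cone = {(u, W). W \<in> psd_mats \<and> u \<le> det W powr (1 / real CARD('n))}"

definition rtdet_barrier :: "real \<times> (real ^ 'n ^ 'n) \<Rightarrow> real" where
  "rtdet_barrier = (\<lambda>(u, W). hgeom_barrier (u, eigenvalues W))"

text \<open>
  The inner product of \<^typ>\<open>real ^ 'n ^ 'n\<close> is the sum of the products of the entries, which on
  symmetric matrices is the trace inner product.
\<close>

definition rtdet_conj_gradient :: "real \<times> (real ^ 'n ^ 'n) \<Rightarrow> real \<times> (real ^ 'n ^ 'n)" where
  "rtdet_conj_gradient = conj_gradient rtdet_space rtdet_cone rtdet_barrier"

end

theory Submission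
  imports Defs
begin

text \<open>
  Both conjugate gradients are instances of one computation. In either cone let \<open>\<phi>\<close> be the mean (the
  geometric mean of a vector, or the \<open>d\<close>-th root of the determinant of a matrix). Since the product
  of the entries or eigenvalues is \<open>\<phi> w ^ d\<close>, the barrier is
  \<open>- ln (\<phi> w - u) - d * ln (\<phi> w)\<close>, and the conjugate barrier at \<open>(p, r)\<close> is the supremum of
  \<open>- p * u - inner r w + ln (\<phi> w - u) + d * ln (\<phi> w)\<close>.

  The inequality \<open>inner r w \<ge> d * \<phi> r * \<phi> w\<close>, with equality for multiples of the reciprocal of \<open>r\<close>
  (entrywise reciprocal or inverse matrix), turns this into a maximization over the two real numbers
  \<open>\<phi> w - u\<close> and \<open>\<phi> w\<close>. The maximizer and the maximal value
  \<open>- 1 - ln (- p) - d - d * ln (\<phi> r + p / d)\<close> are then explicit. The value is a differentiable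
  function of \<open>(p, r)\<close> with the affine minorant given by the maximizer, so its gradient is minus
  the maximizer (\<open>conj_gradient_eq_minus_maximizer\<close>). The locale \<open>geometric_mean_cone\<close> carries this
  out once.

  For vectors the inequality is that of arithmetic and geometric means. For matrices it is the same
  inequality applied to the eigenvalues of a congruent matrix (\<open>inner_ge_det\<close>). That rests on the
  spectral theorem for symmetric matrices, which is proved by maximizing the quadratic form on the
  unit spheres of invariant subspaces.

  Finally, in an eigendecomposition of \<open>R\<close> with orthogonal \<open>U\<close> and eigenvalues \<open>l\<close>, the mean of \<open>l\<close>
  is that of \<open>R\<close>, and conjugating the diagonal matrix of the reciprocals of \<open>l\<close> with \<open>U\<close> gives the
  inverse of \<open>R\<close>; so the two closed forms correspond.
\<close>

section \<open>Conjugate gradients from closed forms\<close>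

lemma interior_in_ball:
  assumes "z \<in> interior_in V K"
  obtains \<epsilon> where "\<epsilon> > 0" "\<And>x. x \<in> V \<Longrightarrow> dist x z < \<epsilon> \<Longrightarrow> x \<in> K"
proof -
  obtain T where "openin (top_of_set V) T" "z \<in> T" "T \<subseteq> K"
    using assms by (auto simp: interior_in_def interior_of_def)
  then show thesis
    using that unfolding openin_contains_ball by (metis Int_iff dist_commute mem_ball subsetD)
qed

lemma interior_in_move:
  assumes "z \<in> interior_in V K" "subspace V" "v \<in> V"
  obtains \<epsilon> where "\<epsilon> > 0" "z + \<epsilon> *\<^sub>R v \<in> K"
proof -
  obtain \<delta> where \<delta>: "\<delta> > 0" "\<And>x. x \<in> V \<Longrightarrow> dist x z < \<delta> \<Longrightarrow> x \<in> K"
    using interior_in_ball assms(1) by metis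
  have z: "z \<in> V"
    using assms(1) openin_imp_subset by (fastforce simp: interior_in_def interior_of_def)
  let ?\<epsilon> = "\<delta> / (norm v + 1)"
  have "?\<epsilon> > 0" using \<delta> by (simp add: add_nonneg_pos)
  moreover have "dist (z + ?\<epsilon> *\<^sub>R v) z < \<delta>"
    using \<delta>(1) by (simp add: dist_norm pos_divide_less_eq add_nonneg_pos)
  then have "z + ?\<epsilon> *\<^sub>R v \<in> K"
    using \<delta>(2) z assms by (simp add: subspace_add subspace_scale)
  ultimately show thesis by (rule that)
qed

lemma has_derivative_along_line:
  fixes h :: "'a::euclidean_space \<Rightarrow> real"
  assumes V: "subspace V" "s \<in> V" "v \<in> V"
    and h: "(h has_derivative D) (at s within V)"
  shows "((\<lambda>t. h (s + t *\<^sub>R v)) has_real_derivative D v) (at 0)"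
proof -
  have "((\<lambda>t::real. s + t *\<^sub>R v) has_derivative (\<lambda>t. t *\<^sub>R v)) (at 0)"
    by (auto intro!: derivative_eq_intros)
  moreover have "range (\<lambda>t::real. s + t *\<^sub>R v) \<subseteq> V"
    using V by (auto intro: subspace_add subspace_scale)
  then have "(h has_derivative D) (at (s + 0 *\<^sub>R v) within range (\<lambda>t::real. s + t *\<^sub>R v))"
    using has_derivative_subset[OF h] by simp
  ultimately have "((\<lambda>t. h (s + t *\<^sub>R v)) has_derivative (\<lambda>t. D (t *\<^sub>R v))) (at 0)"
    by (rule has_derivative_in_compose)
  moreover have "D (t *\<^sub>R v) = D v * t" for t
    using linear_scale[OF has_derivative_linear[OF h]] by simp
  ultimately show ?thesis
    by (simp add: has_field_derivative_def)
qed

text \<open>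
  A derivative within \<open>V\<close> at a point of \<open>V\<close> fixes only the directional derivatives along \<open>V\<close>; that
  is enough here, since \<open>g - g'\<close> is itself such a direction.
\<close>
lemma gradient_in_eqI:
  fixes h :: "'a::euclidean_space \<Rightarrow> real"
  assumes V: "subspace V" "s \<in> V" "g \<in> V"
    and g: "(h has_derivative (\<lambda>x. inner x g)) (at s within V)"
  shows "gradient_in V h s = g"
  unfolding gradient_in_def
proof (rule the_equality)
  fix g' assume g': "g' \<in> V \<and> (h has_derivative (\<lambda>x. inner x g')) (at s within V)"
  have d: "g - g' \<in> V" using V g' by (simp add: subspace_diff)
  have "inner (g - g') g = inner (g - g') g'"
    using DERIV_unique has_derivative_along_line[OF V(1,2) d] g g' by blast
  then have "inner (g - g') (g - g') = 0"
    by (simp add: inner_diff_right)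
  then show "g' = g" by simp
qed (use V g in simp)

text \<open>
  The envelope argument. The conjugate barrier lies above the affine function
  \<open>x \<mapsto> - inner x w - f w\<close> and touches it at \<open>s\<close> when \<open>w\<close> attains the supremum there. Hence a
  closed form \<open>h\<close> has to have gradient \<open>- w\<close> at \<open>s\<close> as soon as it is differentiable, and its
  derivative never has to be computed.
\<close>
lemma conj_gradient_eq_minus_maximizer:
  fixes f h :: "'a::euclidean_space \<Rightarrow> real"
  assumes V: "subspace V" "w \<in> V"
    and T: "openin (top_of_set V) T" "s \<in> T"
    and conj: "\<And>x. x \<in> T \<Longrightarrow> conj_barrier V K f x = h x"
    and minor: "\<And>x. x \<in> T \<Longrightarrow> - inner x w - f w \<le> h x"
    and touch: "h s = - inner s w - f w"
    and diff: "h differentiable (at s within V)"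
  shows "conj_gradient V K f s = - w"
proof -
  obtain D where D: "(h has_derivative D) (at s within V)"
    using diff by (auto simp: differentiable_def)
  have sV: "s \<in> V" using T openin_imp_subset by blast
  obtain e where e: "e > 0" "\<And>x. x \<in> V \<Longrightarrow> dist x s < e \<Longrightarrow> x \<in> T"
    using T unfolding openin_contains_ball by (metis Int_iff dist_commute mem_ball subsetD)
  have lin: "linear D" by (rule has_derivative_linear[OF D])
  have Dv: "D v = - inner v w" if v: "v \<in> V" for v
  proof -
    \<comment> \<open>The gap to the affine minorant vanishes at \<open>s\<close>, which makes \<open>s\<close> a local minimum.\<close>
    let ?\<psi> = "\<lambda>t::real. h (s + t *\<^sub>R v) + inner (s + t *\<^sub>R v) w"
    have "(?\<psi> has_real_derivative D v + inner v w) (at 0)"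
      by (intro DERIV_add has_derivative_along_line[OF V(1) sV v D])
        (auto intro!: derivative_eq_intros simp: inner_add_left)
    moreover have "\<forall>t. \<bar>0 - t\<bar> < e / (norm v + 1) \<longrightarrow> ?\<psi> 0 \<le> ?\<psi> t"
    proof (intro allI impI)
      fix t assume "\<bar>0 - t\<bar> < e / (norm v + 1)"
      then have "\<bar>t\<bar> * norm v + \<bar>t\<bar> < e"
        by (simp add: pos_less_divide_eq add_nonneg_pos distrib_left)
      then have "dist (s + t *\<^sub>R v) s < e"
        by (simp add: dist_norm)
      moreover have "s + t *\<^sub>R v \<in> V"
        using V sV v by (auto intro: subspace_add subspace_scale)
      ultimately have "s + t *\<^sub>R v \<in> T" by (rule e(2)[rotated])
      then show "?\<psi> 0 \<le> ?\<psi> t" using minor[of "s + t *\<^sub>R v"] touch by simp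
    qed
    ultimately have "D v + inner v w = 0"
      using e(1) by (intro DERIV_local_min[of ?\<psi> _ 0 "e / (norm v + 1)"]) (auto simp: add_nonneg_pos)
    then show ?thesis by simp
  qed
  have "(h has_derivative (\<lambda>x. inner x (- w))) (at s within V)"
    unfolding has_derivative_within
  proof
    show "bounded_linear (\<lambda>x. inner x (- w))" by (rule bounded_linear_inner_left)
    have "((\<lambda>y. (1 / norm (y - s)) *\<^sub>R (h y - (h s + D (y - s)))) \<longlongrightarrow> 0) (at s within V)"
      using D unfolding has_derivative_within by blast
    moreover have "D (y - s) = inner (y - s) (- w)" if "y \<in> V" for y
      using Dv[of "y - s"] that sV V by (simp add: subspace_diff)
    ultimately show "((\<lambda>y. (1 / norm (y - s)) *\<^sub>R (h y - (h s + inner (y - s) (- w)))) \<longlongrightarrow> 0) (at s within V)"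
      by (subst Lim_cong_within[where g = "\<lambda>y. (1 / norm (y - s)) *\<^sub>R (h y - (h s + D (y - s)))"]) auto
  qed
  then have "(conj_barrier V K f has_derivative (\<lambda>x. inner x (- w))) (at s within V)"
    by (rule has_derivative_transform_within[OF _ e(1) sV]) (use e conj in auto)
  then show ?thesis
    unfolding conj_gradient_def using V sV by (intro gradient_in_eqI) (auto simp: subspace_neg)
qed

section \<open>Cones below a multiplicative mean\<close>

text \<open>
  What the geometric mean on \<open>\<real>\<^sup>d\<close> and the root-determinant on symmetric matrices have in common:
  a cone \<open>C\<close> that contains its dual, with interior \<open>P\<close> and order unit \<open>e\<close>, a positively
  homogeneous mean \<open>\<phi>\<close>, and the inequality of arithmetic and geometric means
  \<open>n * \<phi> r * \<phi> w \<le> inner r w\<close>, in which the reciprocal of \<open>r\<close> gives equality. The order unit serves to move points of \<open>C\<close> into \<open>P\<close>, which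
  is how interiors are identified.
\<close>

locale geometric_mean_cone =
  fixes S P C :: "'a::euclidean_space set" and \<phi> :: "'a \<Rightarrow> real"
    and e :: 'a and recip :: "'a \<Rightarrow> 'a" and n :: real
  assumes subspace_S: "subspace S"
    and P_subset: "P \<subseteq> C" and C_subset: "C \<subseteq> S"
    and open_P: "openin (top_of_set S) P"
    and zero_C: "0 \<in> C"
    and dual_subset: "\<And>r. r \<in> S \<Longrightarrow> (\<And>w. w \<in> C \<Longrightarrow> 0 \<le> inner r w) \<Longrightarrow> r \<in> C"
    and unit_S: "e \<in> S" and add_unit: "\<And>w \<epsilon>. w \<in> C \<Longrightarrow> 0 < \<epsilon> \<Longrightarrow> w + \<epsilon> *\<^sub>R e \<in> P"
    and mean_pos: "\<And>w. w \<in> P \<Longrightarrow> 0 < \<phi> w" and mean_nonneg: "\<And>w. w \<in> C \<Longrightarrow> 0 \<le> \<phi> w"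
    and P_scale: "\<And>c w. 0 < c \<Longrightarrow> w \<in> P \<Longrightarrow> c *\<^sub>R w \<in> P"
    and mean_scale: "\<And>c w. 0 < c \<Longrightarrow> w \<in> P \<Longrightarrow> \<phi> (c *\<^sub>R w) = c * \<phi> w"
    and mean_diff: "\<And>w. w \<in> P \<Longrightarrow> \<phi> differentiable (at w within S)"
    and dim_pos: "0 < n"
    and inner_ge: "\<And>r w. r \<in> P \<Longrightarrow> w \<in> P \<Longrightarrow> n * \<phi> r * \<phi> w \<le> inner r w"
    and recip_P: "\<And>r. r \<in> P \<Longrightarrow> recip r \<in> P"
    and mean_recip: "\<And>r. r \<in> P \<Longrightarrow> \<phi> (recip r) = 1 / \<phi> r"
    and inner_recip: "\<And>r. r \<in> P \<Longrightarrow> inner r (recip r) = n"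
begin

definition cone :: "(real \<times> 'a) set" where
  "cone = {(u, w). w \<in> C \<and> u \<le> \<phi> w}"

text \<open>
  Both barriers have this form, because the sum of the logarithms of the entries or eigenvalues is
  \<open>n * ln \<phi>\<close>.
\<close>
definition barrier :: "real \<times> 'a \<Rightarrow> real" where
  "barrier = (\<lambda>(u, w). - ln (\<phi> w - u) - n * ln (\<phi> w))"

text \<open>
  The last condition keeps the coefficient of \<open>\<phi> w\<close> in the reduced maximization negative. The set is
  open, it contains the interior of the dual cone, and the conjugate barrier has a closed form on
  all of it.
\<close>
definition dual_interior :: "(real \<times> 'a) set" where
  "dual_interior = {(p, r). p < 0 \<and> r \<in> P \<and> 0 < \<phi> r + p / n}"

lemma P_S: "P \<subseteq> S"
  using P_subset C_subset by blast

lemma continuous_mean: "continuous_on P \<phi>"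
  using mean_diff P_S differentiable_imp_continuous_within continuous_within_subset
  by (metis continuous_on_eq_continuous_within)

lemma subspace_product: "subspace (UNIV \<times> S)"
  by (intro subspace_Times subspace_S subspace_UNIV)

lemma openin_product: "openin (top_of_set (UNIV \<times> S)) (UNIV \<times> P)"
  by (intro openin_Times open_P) simp

lemma openin_positive_part:
  assumes "continuous_on (UNIV \<times> P) k"
  shows "openin (top_of_set (UNIV \<times> S)) {z \<in> UNIV \<times> P. 0 < (k z :: real)}"
proof -
  have "openin (top_of_set (UNIV \<times> P)) ((UNIV \<times> P) \<inter> k -` {0<..})"
    using assms by (rule continuous_openin_preimage_gen) simp
  moreover have "(UNIV \<times> P) \<inter> k -` {0<..} = {z \<in> UNIV \<times> P. 0 < k z}" by auto
  ultimately show ?thesis using openin_trans openin_product by metis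
qed

lemma continuous_mean_snd: "continuous_on (UNIV \<times> P) (\<lambda>z. \<phi> (snd z))"
  by (rule continuous_on_compose2[OF continuous_mean]) (auto intro: continuous_on_snd)

lemma interior_cone: "interior_in (UNIV \<times> S) cone = {(u, w). w \<in> P \<and> u < \<phi> w}" (is "?L = ?R")
proof
  have "openin (top_of_set (UNIV \<times> S)) {z \<in> UNIV \<times> P. 0 < \<phi> (snd z) - fst z}"
    by (intro openin_positive_part continuous_intros continuous_mean_snd)
  moreover have "{z \<in> UNIV \<times> P. 0 < \<phi> (snd z) - fst z} = ?R" by auto
  ultimately have "openin (top_of_set (UNIV \<times> S)) ?R" by (simp only:)
  moreover have "?R \<subseteq> cone" using P_subset by (auto simp: cone_def)
  ultimately show "?R \<subseteq> ?L" unfolding interior_in_def by (intro interior_of_maximal)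
  show "?L \<subseteq> ?R"
  proof clarify
    fix u w assume z: "(u, w) \<in> ?L"
    obtain \<epsilon> where \<epsilon>: "\<epsilon> > 0" "(u, w) + \<epsilon> *\<^sub>R (0, - e) \<in> cone"
      by (rule interior_in_move[OF z subspace_product, of "(0, - e)"])
        (use unit_S subspace_S in \<open>auto simp: subspace_neg\<close>)
    then have "w - \<epsilon> *\<^sub>R e \<in> C" by (simp add: cone_def)
    then have "w \<in> P" using add_unit[of "w - \<epsilon> *\<^sub>R e" \<epsilon>] \<epsilon>(1) by simp
    obtain \<delta> where \<delta>: "\<delta> > 0" "(u, w) + \<delta> *\<^sub>R (1, 0) \<in> cone"
      by (rule interior_in_move[OF z subspace_product, of "(1, 0)"])
        (use subspace_S in \<open>auto simp: subspace_0\<close>)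
    then show "w \<in> P \<and> u < \<phi> w" using \<open>w \<in> P\<close> by (simp add: cone_def)
  qed
qed

text \<open>
  Each condition comes from moving an interior point a little and testing it against one element of
  the cone: against \<open>(0, x)\<close> for \<open>r \<in> P\<close>, against \<open>(- 1, 0)\<close> for \<open>p < 0\<close>, and for the last condition
  against \<open>(\<phi> (recip r), recip r)\<close>, where the mean inequality is an equality.
\<close>
lemma interior_dual_cone_subset:
  "interior_in (UNIV \<times> S) (dual_cone (UNIV \<times> S) cone) \<subseteq> dual_interior"
proof clarify
  fix p r assume z: "(p, r) \<in> interior_in (UNIV \<times> S) (dual_cone (UNIV \<times> S) cone)"
  have C: "w \<in> C" if "(q, w) \<in> dual_cone (UNIV \<times> S) cone" for q w
  proof (rule dual_subset)
    show "w \<in> S" using that by (simp add: dual_cone_def)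
    fix x assume "x \<in> C"
    then have "(0, x) \<in> cone" using mean_nonneg by (simp add: cone_def)
    then show "0 \<le> inner w x" using that by (force simp: dual_cone_def inner_commute)
  qed
  obtain \<epsilon> where \<epsilon>: "\<epsilon> > 0" "(p, r) + \<epsilon> *\<^sub>R (0, - e) \<in> dual_cone (UNIV \<times> S) cone"
    by (rule interior_in_move[OF z subspace_product, of "(0, - e)"])
      (use unit_S subspace_S in \<open>auto simp: subspace_neg\<close>)
  then have "r - \<epsilon> *\<^sub>R e \<in> C" using C by simp
  then have r: "r \<in> P" using add_unit[of "r - \<epsilon> *\<^sub>R e" \<epsilon>] \<epsilon>(1) by simp
  obtain \<delta> where \<delta>: "\<delta> > 0" "(p, r) + \<delta> *\<^sub>R (1, 0) \<in> dual_cone (UNIV \<times> S) cone"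
    by (rule interior_in_move[OF z subspace_product, of "(1, 0)"])
      (use subspace_S in \<open>auto simp: subspace_0\<close>)
  have "(- 1, 0) \<in> cone" using zero_C mean_nonneg[of 0] by (simp add: cone_def)
  then have "inner (- 1, 0) ((p, r) + \<delta> *\<^sub>R (1, 0)) \<ge> 0" using \<delta>(2) unfolding dual_cone_def by blast
  then have p: "p < 0" using \<delta>(1) by simp
  obtain \<eta> where \<eta>: "\<eta> > 0" "(p, r) + \<eta> *\<^sub>R (-1, 0) \<in> dual_cone (UNIV \<times> S) cone"
    by (rule interior_in_move[OF z subspace_product, of "(-1, 0)"])
      (use subspace_S in \<open>auto simp: subspace_0\<close>)
  have "(\<phi> (recip r), recip r) \<in> cone" using recip_P[OF r] P_subset by (auto simp: cone_def)
  then have "inner (\<phi> (recip r), recip r) ((p, r) + \<eta> *\<^sub>R (-1, 0)) \<ge> 0"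
    using \<eta>(2) unfolding dual_cone_def by blast
  then have "0 \<le> (p - \<eta>) / \<phi> r + n"
    using inner_recip[OF r] mean_recip[OF r] by (simp add: inner_commute diff_divide_distrib)
  then have "0 < p + n * \<phi> r"
    using mean_pos[OF r] \<eta>(1) by (simp add: field_simps)
  then have "0 < \<phi> r + p / n" using dim_pos by (simp add: field_simps)
  then show "(p, r) \<in> dual_interior" using p r by (simp add: dual_interior_def)
qed

text \<open>
  Maximizing \<open>- p * u + ln (\<phi> w - u)\<close> over \<open>u\<close> forces \<open>\<phi> w - u = - inverse p\<close>. The mean inequality
  reduces the rest to maximizing \<open>n * (ln x - (\<phi> r + p / n) * x)\<close> over \<open>x = \<phi> w\<close>, with
  \<open>w\<close> the multiple of \<open>recip r\<close> whose mean is the optimal \<open>x = inverse (\<phi> r + p / n)\<close>.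
\<close>
definition maximizer :: "real \<times> 'a \<Rightarrow> real \<times> 'a" where
  "maximizer = (\<lambda>(p, r). (inverse p + inverse (\<phi> r + p / n), (\<phi> r / (\<phi> r + p / n)) *\<^sub>R recip r))"

definition conj_value :: "real \<times> 'a \<Rightarrow> real" where
  "conj_value = (\<lambda>(p, r). - 1 - ln (- p) - n - n * ln (\<phi> r + p / n))"

text \<open>
  With \<open>x = \<phi> w\<close> and \<open>b = \<phi> r + p / n\<close>, two instances of \<open>ln t \<le> t - 1\<close> suffice, at
  \<open>t = - p * (x - u)\<close> and \<open>t = b * x\<close>; both are equalities at the maximizer.
\<close>
lemma objective_le_conj_value:
  assumes s: "s \<in> dual_interior" and z: "z \<in> interior_in (UNIV \<times> S) cone"
  shows "- inner s z - barrier z \<le> conj_value s"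
proof -
  obtain p r where s_eq: "s = (p, r)" by fastforce
  obtain u w where z_eq: "z = (u, w)" by fastforce
  have p: "p < 0" and r: "r \<in> P" and b: "0 < \<phi> r + p / n"
    using s by (auto simp: s_eq dual_interior_def)
  have w: "w \<in> P" and u: "u < \<phi> w" using z by (auto simp: z_eq interior_cone)
  define x where "x = \<phi> w"
  define b where "b = \<phi> r + p / n"
  have x: "x > 0" using mean_pos w by (simp add: x_def)
  have "b > 0" using \<open>0 < \<phi> r + p / n\<close> by (simp add: b_def)
  have t: "x - u > 0" using u by (simp add: x_def)
  have "ln ((- p) * (x - u)) \<le> (- p) * (x - u) - 1"
    by (intro ln_le_minus_one mult_pos_pos t) (simp add: p)
  then have 1: "ln (x - u) \<le> - p * (x - u) - 1 - ln (- p)"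
    using ln_mult_pos[of "- p" "x - u"] p t by simp
  have "ln (b * x) \<le> b * x - 1"
    by (intro ln_le_minus_one mult_pos_pos x \<open>b > 0\<close>)
  then have "ln x \<le> b * x - 1 - ln b"
    using x \<open>b > 0\<close> by (simp add: ln_mult_pos)
  then have "n * ln x \<le> n * (b * x - 1 - ln b)"
    using dim_pos by (intro mult_left_mono) auto
  then have "n * ln x \<le> n * (b * x) - n - n * ln b"
    by (simp add: right_diff_distrib)
  moreover have "n * (b * x) \<le> inner r w + p * x"
    using inner_ge[OF r w] dim_pos by (simp add: b_def x_def field_simps)
  moreover have "barrier z = - ln (x - u) - n * ln x" "inner s z = p * u + inner r w"
    "conj_value s = - 1 - ln (- p) - n - n * ln b"
    by (simp_all add: s_eq z_eq barrier_def conj_value_def x_def b_def)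
  moreover have "- p * (x - u) = p * u - p * x" by (simp add: algebra_simps)
  ultimately show ?thesis
    using 1 by linarith
qed

lemma mean_maximizer:
  assumes "(p, r) \<in> dual_interior"
  shows "\<phi> (snd (maximizer (p, r))) = inverse (\<phi> r + p / n)"
proof -
  have "r \<in> P" "0 < \<phi> r + p / n" "0 < \<phi> r" using assms mean_pos by (auto simp: dual_interior_def)
  then show ?thesis
    by (simp add: maximizer_def mean_scale recip_P mean_recip field_simps)
qed

lemma maximizer_interior:
  assumes "s \<in> dual_interior"
  shows "maximizer s \<in> interior_in (UNIV \<times> S) cone"
proof -
  obtain p r where s_eq: "s = (p, r)" by fastforce
  have "p < 0" "r \<in> P" "0 < \<phi> r + p / n" "0 < \<phi> r"
    using assms mean_pos by (auto simp: s_eq dual_interior_def)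
  then show ?thesis
    using mean_maximizer[of p r] assms P_scale recip_P
    by (auto simp: s_eq interior_cone maximizer_def)
qed

lemma conj_value_attained:
  assumes s: "s \<in> dual_interior"
  shows "- inner s (maximizer s) - barrier (maximizer s) = conj_value s"
proof -
  obtain p r where s_eq: "s = (p, r)" by fastforce
  have p: "p < 0" and r: "r \<in> P" and "0 < \<phi> r + p / n"
    using s by (auto simp: s_eq dual_interior_def)
  define b where "b = \<phi> r + p / n"
  have b: "b > 0" using \<open>0 < \<phi> r + p / n\<close> by (simp add: b_def)
  have "ln (- inverse p) = - ln (- p)"
    using p by (metis inverse_minus_eq ln_inverse neg_0_less_iff_less)
  then have "barrier (maximizer s) = ln (- p) + n * ln b"
    using mean_maximizer[of p r] s b
    by (simp add: s_eq barrier_def maximizer_def b_def[symmetric] ln_inverse)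
  moreover have "inner s (maximizer s) = p * inverse p + (p + \<phi> r * n) / b"
    by (simp add: s_eq maximizer_def b_def[symmetric] inner_recip[OF r])
      (simp add: divide_inverse algebra_simps)
  moreover have "p + \<phi> r * n = n * b" using dim_pos by (simp add: b_def field_simps)
  moreover have "conj_value s = - 1 - ln (- p) - n - n * ln b"
    by (simp add: s_eq conj_value_def b_def)
  ultimately show ?thesis using p b by simp
qed

lemma conj_barrier_eq:
  assumes "s \<in> dual_interior"
  shows "conj_barrier (UNIV \<times> S) cone barrier s = conj_value s"
  unfolding conj_barrier_def
proof (rule cSup_eq_maximum)
  show "conj_value s \<in> (\<lambda>w. - inner s w - barrier w) ` interior_in (UNIV \<times> S) cone"
    by (rule image_eqI[where x = "maximizer s"])
      (simp_all only: conj_value_attained[OF assms] maximizer_interior[OF assms])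
qed (use objective_le_conj_value[OF assms] in auto)

lemma openin_dual_interior: "openin (top_of_set (UNIV \<times> S)) dual_interior"
proof -
  have "openin (top_of_set (UNIV \<times> S)) {z \<in> UNIV \<times> P. 0 < \<phi> (snd z) + fst z / n}"
    using dim_pos by (intro openin_positive_part continuous_intros continuous_mean_snd) auto
  moreover have "openin (top_of_set (UNIV \<times> S)) {z \<in> UNIV \<times> P. 0 < - (fst z :: real)}"
    by (intro openin_positive_part continuous_intros)
  moreover have "dual_interior = {z \<in> UNIV \<times> P. 0 < \<phi> (snd z) + fst z / n} \<inter> {z \<in> UNIV \<times> P. 0 < - fst z}"
    unfolding dual_interior_def by auto
  ultimately show ?thesis by (simp only: openin_Int)
qed

lemma conj_value_differentiable:
  assumes "s \<in> dual_interior"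
  shows "conj_value differentiable (at s within UNIV \<times> S)"
proof -
  obtain p r where s_eq: "s = (p, r)" by fastforce
  have p: "p < 0" and r: "r \<in> P" and b: "0 < \<phi> r + p / n"
    using assms by (auto simp: s_eq dual_interior_def)
  have "snd ` (UNIV \<times> S) = S" by auto
  then have "\<phi> differentiable (at (snd s) within snd ` (UNIV \<times> S))"
    using mean_diff[OF r] by (simp add: s_eq)
  then have "(\<lambda>z. \<phi> (snd z)) differentiable (at s within UNIV \<times> S)"
    using bounded_linear_imp_differentiable[OF bounded_linear_snd]
    by (rule differentiable_in_compose[where g = snd])
  moreover have "fst differentiable (at s within UNIV \<times> S)"
    by (rule bounded_linear_imp_differentiable[OF bounded_linear_fst])
  ultimately have b_diff: "(\<lambda>z. \<phi> (snd z) + fst z / n) differentiable (at s within UNIV \<times> S)"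
    and p_diff: "(\<lambda>z. - fst z) differentiable (at s within UNIV \<times> S)"
    using dim_pos by (auto intro!: differentiable_add differentiable_divide)
  have ln_diff: "(\<lambda>z. ln (g z)) differentiable (at s within UNIV \<times> S)"
    if "g differentiable (at s within UNIV \<times> S)" "0 < g s" for g :: "real \<times> 'a \<Rightarrow> real"
    using that has_derivative_ln unfolding differentiable_def by blast
  have "(\<lambda>z. ln (- fst z)) differentiable (at s within UNIV \<times> S)"
    by (rule ln_diff[OF p_diff]) (simp add: s_eq p)
  moreover have "(\<lambda>z. ln (\<phi> (snd z) + fst z / n)) differentiable (at s within UNIV \<times> S)"
    by (rule ln_diff[OF b_diff]) (simp add: s_eq b)
  ultimately have "(\<lambda>z. - 1 - ln (- fst z) - n - n * ln (\<phi> (snd z) + fst z / n))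
      differentiable (at s within UNIV \<times> S)"
    by (intro differentiable_diff differentiable_mult differentiable_const)
  moreover have "conj_value = (\<lambda>z. - 1 - ln (- fst z) - n - n * ln (\<phi> (snd z) + fst z / n))"
    by (auto simp: conj_value_def)
  ultimately show ?thesis by simp
qed

text \<open>
  The cone and the barrier are variables here, so that concrete barriers have to agree with
  \<open>barrier\<close> on the interior of the cone only.
\<close>
lemma conj_gradient_eq:
  assumes s: "(p, r) \<in> dual_interior"
    and K: "K = cone"
    and f: "\<And>z. z \<in> interior_in (UNIV \<times> S) cone \<Longrightarrow> f z = barrier z"
  shows "conj_gradient (UNIV \<times> S) K f (p, r) =
    (- inverse p - inverse (\<phi> r + p / n), - (\<phi> r / (\<phi> r + p / n)) *\<^sub>R recip r)"
proof -
  let ?m = "maximizer (p, r)"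
  have m: "?m \<in> interior_in (UNIV \<times> S) cone" by (rule maximizer_interior[OF s])
  have "conj_gradient (UNIV \<times> S) K f (p, r) = - ?m"
  proof (rule conj_gradient_eq_minus_maximizer[OF subspace_product _ openin_dual_interior s])
    show "?m \<in> UNIV \<times> S" using m P_S by (auto simp: interior_cone)
    fix x assume x: "x \<in> dual_interior"
    have "conj_barrier (UNIV \<times> S) K f x = conj_barrier (UNIV \<times> S) cone barrier x"
      unfolding conj_barrier_def K by (rule SUP_cong) (simp_all add: f)
    then show "conj_barrier (UNIV \<times> S) K f x = conj_value x"
      by (simp add: conj_barrier_eq[OF x])
    show "- inner x ?m - f ?m \<le> conj_value x"
      using objective_le_conj_value[OF x m] by (simp add: f m)
  next
    show "conj_value (p, r) = - inner (p, r) ?m - f ?m"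
      using conj_value_attained[OF s] by (simp add: f m)
  qed (rule conj_value_differentiable[OF s])
  then show ?thesis by (simp add: maximizer_def)
qed

end

section \<open>The spectral theorem for symmetric matrices\<close>

text \<open>
  A maximizer \<open>v\<close> of the quadratic form on the unit sphere of \<open>T\<close> is an eigenvector. With the maximum
  \<open>c\<close>, the function \<open>inner x (f x) - c * inner x x\<close> is nonpositive on \<open>T\<close> and vanishes at \<open>v\<close>; its
  derivative at \<open>v\<close> in the direction of the residual \<open>y = f v - c *\<^sub>R v\<close> is \<open>2 * inner y y\<close>, so
  \<open>y = 0\<close>.
\<close>
lemma selfadjoint_eigenvector_in_subspace:
  fixes f :: "'a::euclidean_space \<Rightarrow> 'a"
  assumes f: "linear f" and sym: "\<And>x y. inner x (f y) = inner (f x) y"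
    and T: "subspace T" "f ` T \<subseteq> T" "x0 \<in> T" "x0 \<noteq> 0"
  obtains v c where "v \<in> T" "norm v = 1" "f v = c *\<^sub>R v"
proof -
  let ?S = "T \<inter> sphere 0 1"
  have "compact ?S"
    using closed_subspace[OF T(1)] by (simp add: closed_Int_compact)
  moreover have "(1 / norm x0) *\<^sub>R x0 \<in> ?S"
    using T by (simp add: subspace_scale)
  then have "?S \<noteq> {}" by blast
  moreover have "continuous_on ?S (\<lambda>x. inner x (f x))"
    by (intro continuous_intros linear_continuous_on linear_linear[THEN iffD2] f)
  ultimately obtain v where v: "v \<in> ?S" and max: "\<And>x. x \<in> ?S \<Longrightarrow> inner x (f x) \<le> inner v (f v)"
    using continuous_attains_sup[of ?S "\<lambda>x. inner x (f x)"] by blast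
  define c where "c = inner v (f v)"
  have vT: "v \<in> T" and v1: "norm v = 1" using v by auto
  have bound: "inner x (f x) \<le> c * inner x x" if x: "x \<in> T" for x
  proof (cases "x = 0")
    case False
    then have "(1 / norm x) *\<^sub>R x \<in> ?S" using x T(1) by (simp add: subspace_scale)
    from max[OF this] have "(inner x (f x)) / (norm x)^2 \<le> c"
      by (simp add: c_def linear_scale[OF f] power2_eq_square)
    then show ?thesis using False by (simp add: pos_divide_le_eq power2_norm_eq_inner)
  qed (simp add: linear_0[OF f])
  define y where "y = f v - c *\<^sub>R v"
  have yT: "y \<in> T" unfolding y_def using vT T by (intro subspace_diff subspace_scale) auto
  let ?q = "\<lambda>t. inner (v + t *\<^sub>R y) (f (v + t *\<^sub>R y)) - c * inner (v + t *\<^sub>R y) (v + t *\<^sub>R y)"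
  have q: "?q t = 2 * inner y y * t + (inner y (f y) - c * inner y y) * t\<^sup>2" for t
  proof -
    have "?q t = (inner v (f v) - c * inner v v) + 2 * t * (inner y (f v) - c * inner y v)
        + t\<^sup>2 * (inner y (f y) - c * inner y y)"
      using sym[of v y] inner_commute[of "f v" y] inner_commute[of v y]
      by (simp add: linear_add[OF f] linear_scale[OF f] inner_add_left inner_add_right
          power2_eq_square algebra_simps)
    moreover have "inner v (f v) - c * inner v v = 0"
      using v1 by (simp add: c_def flip: power2_norm_eq_inner)
    moreover have "inner y (f v) - c * inner y v = inner y y"
      by (simp add: y_def inner_diff_right)
    ultimately show ?thesis by (simp add: algebra_simps)
  qed
  have "(?q has_real_derivative 2 * inner y y) (at 0)"
    unfolding q by (auto intro!: derivative_eq_intros)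
  moreover have "?q t \<le> ?q 0" for t
    using bound[of "v + t *\<^sub>R y"] vT yT T(1) v1
    by (simp add: c_def subspace_add subspace_scale flip: power2_norm_eq_inner)
  ultimately have "2 * inner y y = 0"
    by (intro DERIV_local_max[of ?q _ 0 1]) auto
  then have "f v = c *\<^sub>R v" by (simp add: y_def)
  with vT v1 show thesis by (rule that)
qed

text \<open>
  A largest orthonormal set of eigenvectors spans: otherwise its orthogonal complement is a nonzero
  invariant subspace and contains a further eigenvector.
\<close>
lemma selfadjoint_orthonormal_eigenbasis:
  fixes f :: "'a::euclidean_space \<Rightarrow> 'a"
  assumes f: "linear f" and sym: "\<And>x y. inner x (f y) = inner (f x) y"
  obtains B where "finite B" "card B = DIM('a)" "pairwise orthogonal B"
    "\<forall>b\<in>B. norm b = 1" "\<forall>b\<in>B. \<exists>c. f b = c *\<^sub>R b"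
proof -
  define Q where "Q B \<longleftrightarrow> pairwise orthogonal B \<and> (\<forall>b\<in>B. norm b = 1 \<and> (\<exists>c. f b = c *\<^sub>R b))" for B
  have indep: "independent B" if "Q B" for B
  proof (rule pairwise_orthogonal_independent)
    show "pairwise orthogonal B" using that by (simp add: Q_def)
    show "0 \<notin> B" using that by (metis Q_def norm_zero zero_neq_one)
  qed
  have "Q {}" by (simp add: Q_def)
  moreover have "\<forall>B. Q B \<longrightarrow> card B < Suc DIM('a)"
    by (intro allI impI le_imp_less_Suc independent_bound[THEN conjunct2] indep)
  ultimately obtain B where B: "Q B" and max: "\<And>B'. Q B' \<Longrightarrow> card B' \<le> card B"
    using ex_has_greatest_nat[of Q "{}" card "Suc DIM('a)"] by auto
  have fin: "finite B" using indep[OF B] independent_bound by blast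
  have "span B = UNIV"
  proof (rule ccontr)
    assume "span B \<noteq> UNIV"
    then have "span B \<subset> span UNIV" by auto
    then obtain x0 where x0: "x0 \<noteq> 0" "\<And>y. y \<in> span B \<Longrightarrow> orthogonal x0 y"
      using orthogonal_to_subspace_exists_gen[of B UNIV] by metis
    let ?T = "{y. \<forall>x\<in>B. orthogonal x y}"
    have inv: "f ` ?T \<subseteq> ?T"
    proof clarify
      fix y b assume y: "\<forall>x\<in>B. orthogonal x y" and b: "b \<in> B"
      obtain c where "f b = c *\<^sub>R b" using B b by (auto simp: Q_def)
      then show "orthogonal b (f y)" using y b sym[of b y] by (simp add: orthogonal_def)
    qed
    have "x0 \<in> ?T" using x0(2) by (simp add: span_base orthogonal_commute)
    then obtain v c where v: "v \<in> ?T" "norm v = 1" "f v = c *\<^sub>R v"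
      by (rule selfadjoint_eigenvector_in_subspace[OF f sym subspace_orthogonal_to_vectors inv _ x0(1)])
    have "v \<notin> B" using v(1,2) by (auto simp: orthogonal_def)
    moreover have "Q (insert v B)"
      using B v by (auto simp: Q_def pairwise_insert orthogonal_commute)
    then have "card (insert v B) \<le> card B" by (rule max)
    ultimately show False using fin by simp
  qed
  then have "card B = DIM('a)"
    using indep[OF B] by (metis dim_UNIV dim_eq_card dim_span)
  with B fin show thesis by (intro that[of B]) (auto simp: Q_def)
qed

lemma matrix_mult_Diag: "(A ** Diag v) $ i $ j = A $ i $ j * v $ j"
  by (simp add: Diag_def matrix_matrix_mult_def if_distrib cong: if_cong)

lemma transpose_Diag [simp]: "transpose (Diag v) = Diag v"
  by (auto simp: Diag_def transpose_def vec_eq_iff)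

lemma Diag_mult: "Diag v ** Diag w = Diag (\<chi> i. v $ i * w $ i)"
  by (auto simp: vec_eq_iff matrix_mult_Diag) (auto simp: Diag_def)

lemma Diag_vector: "Diag v *v x = (\<chi> i. v $ i * x $ i)"
  by (auto simp: Diag_def matrix_vector_mult_def vec_eq_iff if_distrib if_distribR cong: if_cong)

lemma det_Diag: "det (Diag v) = (\<Prod>i\<in>UNIV. v $ i)"
  by (subst det_diagonal) (auto simp: Diag_def)

lemma Diag_scaleR: "Diag (c *\<^sub>R v) = c *\<^sub>R Diag v"
  by (auto simp: Diag_def vec_eq_iff)

lemma scaleR_conjugate:
  fixes A B D :: "real ^ 'n ^ 'n"
  shows "A ** (c *\<^sub>R D) ** B = c *\<^sub>R (A ** D ** B)"
  by (simp add: vec_eq_iff matrix_matrix_mult_def sum_distrib_left sum_distrib_right mult_ac)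

lemma inner_matrix_vector_transpose:
  fixes A :: "real ^ 'n ^ 'm"
  shows "inner x (A *v y) = inner (transpose A *v x) y"
  by (metis dot_lmul_matrix vector_transpose_matrix transpose_transpose)

lemma symmetric_eigendecomposition:
  fixes W :: "real ^ 'n ^ 'n"
  assumes "W \<in> sym_mats"
  obtains U l where "eigendecomposition W U l"
proof -
  have W: "transpose W = W" using assms by (simp add: sym_mats_def)
  have sym: "inner x (W *v y) = inner (W *v x) y" for x y
    using inner_matrix_vector_transpose[of x W y] W by simp
  obtain B where B: "finite B" "card B = DIM(real^'n)" "pairwise orthogonal B"
    "\<forall>b\<in>B. norm b = 1" "\<forall>b\<in>B. \<exists>c. W *v b = c *\<^sub>R b"
    by (rule selfadjoint_orthonormal_eigenbasis[OF matrix_vector_mul_linear sym])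
  have "card (UNIV :: 'n set) = card B" using B(2) by simp
  then obtain b where b: "bij_betw b (UNIV :: 'n set) B"
    using finite_same_card_bij[OF finite_class.finite_UNIV B(1)] by blast
  have bB: "b j \<in> B" for j using b by (auto simp: bij_betw_def)
  then have "\<exists>c. W *v b j = c *\<^sub>R b j" for j using B(5) by blast
  then obtain c where c: "\<And>j. W *v b j = c j *\<^sub>R b j" by metis
  define U :: "real^'n^'n" where "U = (\<chi> i j. b j $ i)"
  define l :: "real^'n" where "l = (\<chi> j. c j)"
  have col: "column j U = b j" for j by (simp add: U_def column_def vec_eq_iff)
  have U: "orthogonal_matrix U"
    unfolding orthogonal_matrix_orthonormal_columns col
    using B(3,4) bB b by (simp add: pairwise_def bij_betw_def inj_on_def) metis
  have "(W ** U) $ i $ j = (U ** Diag l) $ i $ j" for i j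
  proof -
    have "(W ** U) $ i $ j = (W *v b j) $ i"
      by (simp add: matrix_matrix_mult_def matrix_vector_mult_def U_def)
    then show ?thesis by (simp add: c matrix_mult_Diag l_def U_def)
  qed
  then have "W ** U = U ** Diag l" by (simp add: vec_eq_iff)
  then have "W ** (U ** transpose U) = U ** Diag l ** transpose U"
    by (simp add: matrix_mul_assoc)
  then have "eigendecomposition W U l"
    using U by (simp add: eigendecomposition_def orthogonal_matrix_def)
  then show thesis by (rule that)
qed

section \<open>Positive definite matrices\<close>

definition pd_mats :: "(real ^ 'n ^ 'n) set" where
  "pd_mats = {W \<in> sym_mats. \<forall>x. x \<noteq> 0 \<longrightarrow> 0 < inner x (W *v x)}"

lemma eigendecomposition_quadratic:
  assumes "eigendecomposition W U l"
  shows "inner x (W *v x) = (\<Sum>i\<in>UNIV. l $ i * ((x v* U) $ i)\<^sup>2)"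
proof -
  have "inner x (W *v x) = inner (x v* U) (Diag l *v (x v* U))"
    using assms by (simp add: eigendecomposition_def dot_lmul_matrix flip: matrix_vector_mul_assoc)
  then show ?thesis
    by (simp add: Diag_vector inner_vec_def power2_eq_square mult_ac)
qed

lemma eigendecomposition_eigenvalue:
  assumes "eigendecomposition W U l"
  shows "l $ i = inner (U *v axis i 1) (W *v (U *v axis i 1))" "U *v axis i 1 \<noteq> 0"
proof -
  have axis: "(U *v axis i 1) v* U = axis i 1"
    using assms unfolding eigendecomposition_def orthogonal_matrix_def
    by (metis matrix_vector_mul_assoc matrix_vector_mul_lid transpose_matrix_vector)
  then show "U *v axis i 1 \<noteq> 0"
    by (metis axis_eq_0_iff vector_matrix_mult_0 zero_neq_one)
  show "l $ i = inner (U *v axis i 1) (W *v (U *v axis i 1))"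
    unfolding eigendecomposition_quadratic[OF assms] axis
    by (simp add: axis_def if_distrib[of "\<lambda>t. t\<^sup>2"] if_distrib[of "\<lambda>t. _ * t"] cong: if_cong)
qed

lemma eigendecomposition_symmetric:
  "eigendecomposition W U l \<Longrightarrow> W \<in> sym_mats"
  by (auto simp: eigendecomposition_def sym_mats_def matrix_transpose_mul matrix_mul_assoc)

lemma orthogonal_matrix_norm:
  fixes U :: "real ^ 'n ^ 'n"
  assumes "orthogonal_matrix U"
  shows "inner (x v* U) (x v* U) = inner x x"
proof -
  have "U *v (x v* U) = x"
    using assms unfolding orthogonal_matrix_def
    by (metis matrix_vector_mul_assoc matrix_vector_mul_lid transpose_matrix_vector)
  then show ?thesis by (simp add: dot_lmul_matrix)
qed

lemma pd_mats_iff_eigenvalues: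
  fixes l :: "real ^ 'n"
  assumes "eigendecomposition W U l"
  shows "W \<in> pd_mats \<longleftrightarrow> (\<forall>i. 0 < l $ i)"
proof
  assume "W \<in> pd_mats"
  then show "\<forall>i. 0 < l $ i"
    using eigendecomposition_eigenvalue[OF assms] by (simp add: pd_mats_def)
next
  assume l: "\<forall>i. 0 < l $ i"
  have "0 < inner x (W *v x)" if "x \<noteq> 0" for x
  proof -
    have "inner (x v* U) (x v* U) \<noteq> 0"
      using that assms by (simp add: orthogonal_matrix_norm eigendecomposition_def)
    then obtain i where "(x v* U) $ i \<noteq> 0" by (auto simp: vec_eq_iff)
    then show ?thesis
      unfolding eigendecomposition_quadratic[OF assms] using l
      by (intro sum_pos2[of _ i]) (auto simp: less_imp_le)
  qed
  then show "W \<in> pd_mats"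
    using eigendecomposition_symmetric[OF assms] by (simp add: pd_mats_def)
qed

lemma psd_mats_eigenvalues:
  assumes "eigendecomposition W U l" "W \<in> psd_mats"
  shows "0 \<le> l $ i"
  using eigendecomposition_eigenvalue[OF assms(1)] assms(2) by (simp add: psd_mats_def)

lemma det_eigendecomposition:
  assumes "eigendecomposition W U l"
  shows "det W = (\<Prod>i\<in>UNIV. l $ i)"
proof -
  have "det U * det (transpose U) = 1"
    using assms by (metis det_I det_mul eigendecomposition_def orthogonal_matrix_def)
  then show ?thesis using assms by (simp add: eigendecomposition_def det_mul det_Diag)
qed

lemma trace_eigendecomposition:
  assumes "eigendecomposition W U l"
  shows "trace W = (\<Sum>i\<in>UNIV. l $ i)"
proof -
  have "trace W = trace (transpose U ** (U ** Diag l))"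
    using assms by (simp add: eigendecomposition_def trace_mul_sym[of "U ** Diag l" "transpose U"])
  also have "\<dots> = trace (Diag l)"
    using assms by (simp add: eigendecomposition_def orthogonal_matrix_def matrix_mul_assoc)
  finally show ?thesis by (simp add: trace_def Diag_def)
qed

lemma inner_eq_trace:
  fixes A B :: "real ^ 'n ^ 'n"
  shows "inner A B = trace (transpose A ** B)"
  unfolding trace_def inner_vec_def matrix_matrix_mult_def transpose_def
  by simp (rule sum.swap)

text \<open>
  Rank-one matrices turn values of a quadratic form into inner products of matrices: testing against
  them shows that the cone of positive semidefinite matrices contains its dual, and bounds quadratic
  forms by the norm.
\<close>
definition outer :: "real ^ 'n \<Rightarrow> real ^ 'n ^ 'n" where
  "outer x = (\<chi> i j. x $ i * x $ j)"

lemma inner_outer: "inner A (outer x) = inner x (A *v x)"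
  by (simp add: outer_def inner_vec_def matrix_vector_mult_def sum_distrib_left mult_ac)

lemma outer_vector: "outer x *v y = inner x y *\<^sub>R x"
  by (simp add: outer_def inner_vec_def matrix_vector_mult_def vec_eq_iff sum_distrib_left mult_ac)

lemma outer_psd: "outer x \<in> psd_mats"
  by (auto simp: psd_mats_def sym_mats_def outer_vector)
    (auto simp: outer_def transpose_def vec_eq_iff inner_commute)

text \<open>
  The quadratic form of \<open>A\<close> at \<open>x\<close> is the inner product of \<open>A\<close> with \<open>outer x\<close>, so this is the
  Cauchy--Schwarz inequality for matrices.
\<close>
lemma abs_quadratic_le:
  fixes A :: "real ^ 'n ^ 'n"
  shows "\<bar>inner x (A *v x)\<bar> \<le> norm A * inner x x"
proof -
  have "norm (outer x) = inner x x"
    using inner_outer[of "outer x" x] by (simp add: outer_vector norm_eq_sqrt_inner)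
  then show ?thesis using Cauchy_Schwarz_ineq2[of A "outer x"] by (simp add: inner_outer)
qed

lemma subspace_sym_mats: "subspace sym_mats"
  by (auto simp: subspace_def sym_mats_def transpose_def vec_eq_iff)

lemma mat_1_sym: "mat 1 \<in> sym_mats"
  by (simp add: sym_mats_def)

lemma pd_mats_psd: "pd_mats \<subseteq> psd_mats"
proof
  fix W :: "real^'n^'n" assume W: "W \<in> pd_mats"
  have "0 \<le> inner x (W *v x)" for x
    using W by (cases "x = 0") (auto simp: pd_mats_def less_imp_le)
  then show "W \<in> psd_mats" using W by (simp add: pd_mats_def psd_mats_def)
qed

lemma pd_mats_coercive:
  fixes W :: "real ^ 'n ^ 'n"
  assumes "W \<in> pd_mats"
  obtains c where "0 < c" "\<And>x. c * inner x x \<le> inner x (W *v x)"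
proof -
  obtain U l where E: "eigendecomposition W U l"
    using assms symmetric_eigendecomposition by (auto simp: pd_mats_def)
  define c where "c = Min (range (($) l))"
  have "c \<in> range (($) l)" unfolding c_def by (rule Min_in) auto
  then have "0 < c" using assms pd_mats_iff_eigenvalues[OF E] by auto
  moreover have "c * inner x x \<le> inner x (W *v x)" for x
  proof -
    have "c * inner x x = c * inner (x v* U) (x v* U)"
      using E by (simp add: eigendecomposition_def orthogonal_matrix_norm)
    also have "\<dots> = (\<Sum>i\<in>UNIV. c * ((x v* U) $ i)\<^sup>2)"
      by (simp add: inner_vec_def sum_distrib_left power2_eq_square)
    also have "\<dots> \<le> (\<Sum>i\<in>UNIV. l $ i * ((x v* U) $ i)\<^sup>2)"
      by (intro sum_mono mult_right_mono) (auto simp: c_def)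
    finally show ?thesis by (simp add: eigendecomposition_quadratic[OF E])
  qed
  ultimately show thesis by (rule that)
qed

text \<open>
  The quadratic form of a positive definite \<open>W\<close> is at least \<open>c * inner x x\<close>, and a change of
  \<open>W\<close> by less than \<open>c\<close> in norm cannot cancel that.
\<close>
lemma openin_pd_mats: "openin (top_of_set sym_mats) (pd_mats :: (real ^ 'n ^ 'n) set)"
  unfolding openin_contains_ball
proof (intro conjI ballI)
  fix W :: "real^'n^'n" assume "W \<in> pd_mats"
  then obtain c where c: "0 < c" "\<And>x. c * inner x x \<le> inner x (W *v x)"
    using pd_mats_coercive by metis
  have "ball W c \<inter> sym_mats \<subseteq> pd_mats"
  proof
    fix V assume V: "V \<in> ball W c \<inter> sym_mats"
    have "0 < inner x (V *v x)" if "x \<noteq> 0" for x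
    proof -
      have "inner x (W *v x) - inner x (V *v x) \<le> norm (W - V) * inner x x"
        using abs_quadratic_le[of x "W - V"]
        by (simp add: matrix_vector_mult_diff_rdistrib inner_diff_right)
      moreover have "norm (W - V) * inner x x < c * inner x x"
        using V that by (simp add: dist_norm)
      ultimately show ?thesis using c(2)[of x] by linarith
    qed
    then show "V \<in> pd_mats" using V by (simp add: pd_mats_def)
  qed
  with c(1) show "\<exists>e>0. ball W e \<inter> sym_mats \<subseteq> pd_mats" by blast
qed (auto simp: pd_mats_def)

lemma matrix_inv_eqI:
  fixes A :: "real ^ 'n ^ 'n"
  assumes "A ** B = mat 1"
  shows "matrix_inv A = B"
proof -
  have "B ** A = mat 1" using assms by (rule matrix_left_right_inverse[THEN iffD1])
  with assms have "\<exists>X. A ** X = mat 1 \<and> X ** A = mat 1" by blast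
  from someI_ex[OF this] have "A ** matrix_inv A = mat 1" by (simp add: matrix_inv_def)
  then have "B = (B ** A) ** matrix_inv A" by (simp flip: matrix_mul_assoc)
  then show ?thesis using \<open>B ** A = mat 1\<close> by simp
qed

lemma matrix_inv_eigendecomposition:
  fixes R :: "real ^ 'n ^ 'n"
  assumes E: "eigendecomposition R U l" and l: "\<And>i. l $ i \<noteq> 0"
  shows "R ** matrix_inv R = mat 1" "eigendecomposition (matrix_inv R) U (\<chi> i. inverse (l $ i))"
proof -
  let ?B = "U ** Diag (\<chi> i. inverse (l $ i)) ** transpose U"
  have U: "transpose U ** U = mat 1" "U ** transpose U = mat 1"
    using E by (auto simp: eigendecomposition_def orthogonal_matrix_def)
  have "Diag l ** Diag (\<chi> i. inverse (l $ i)) = mat 1"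
    using l by (auto simp: Diag_mult) (auto simp: Diag_def mat_def vec_eq_iff)
  moreover have "R ** ?B = U ** (Diag l ** ((transpose U ** U) ** Diag (\<chi> i. inverse (l $ i)))) ** transpose U"
    using E by (simp add: eigendecomposition_def matrix_mul_assoc)
  ultimately have "R ** ?B = mat 1" using U by simp
  then have "matrix_inv R = ?B" by (rule matrix_inv_eqI)
  then show "R ** matrix_inv R = mat 1" "eigendecomposition (matrix_inv R) U (\<chi> i. inverse (l $ i))"
    using E \<open>R ** ?B = mat 1\<close> by (auto simp: eigendecomposition_def)
qed

lemma pd_eigendecomposition:
  fixes R :: "real ^ 'n ^ 'n"
  assumes "R \<in> pd_mats"
  obtains U l where "eigendecomposition R U l" "\<forall>i. 0 < l $ i"
proof -
  have "R \<in> sym_mats" using assms by (simp add: pd_mats_def)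
  then obtain U l where "eigendecomposition R U l" by (rule symmetric_eigendecomposition)
  then show thesis using assms pd_mats_iff_eigenvalues that by blast
qed

lemma det_pd_pos: "R \<in> pd_mats \<Longrightarrow> 0 < det R"
  by (rule pd_eigendecomposition, assumption) (simp add: det_eigendecomposition prod_pos)

lemma det_psd_nonneg: "R \<in> psd_mats \<Longrightarrow> 0 \<le> det R"
proof -
  assume R: "R \<in> psd_mats"
  then obtain U l where "eigendecomposition R U l"
    using symmetric_eigendecomposition by (auto simp: psd_mats_def)
  then show ?thesis
    using psd_mats_eigenvalues[OF _ R] by (simp add: det_eigendecomposition prod_nonneg)
qed

lemma matrix_inv_pd:
  fixes R :: "real ^ 'n ^ 'n"
  assumes "R \<in> pd_mats"
  shows "R ** matrix_inv R = mat 1" "matrix_inv R \<in> pd_mats"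
proof -
  obtain U l where E: "eigendecomposition R U l" and l: "\<forall>i. 0 < l $ i"
    by (rule pd_eigendecomposition[OF assms])
  then have l0: "\<And>i. l $ i \<noteq> 0" by (metis less_irrefl)
  show "R ** matrix_inv R = mat 1" by (rule matrix_inv_eigendecomposition[OF E l0])
  show "matrix_inv R \<in> pd_mats"
    using pd_mats_iff_eigenvalues[OF matrix_inv_eigendecomposition(2)[OF E l0]] l by simp
qed

text \<open>
  The inequality of arithmetic and geometric means for the eigenvalues.
\<close>
lemma trace_ge_det:
  fixes M :: "real ^ 'n ^ 'n"
  assumes M: "M \<in> psd_mats"
  shows "CARD('n) * det M powr (1 / CARD('n)) \<le> trace M"
proof -
  obtain U m where E: "eigendecomposition M U m"
    using M symmetric_eigendecomposition by (auto simp: psd_mats_def)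
  have "det M powr (1 / CARD('n)) \<le> (\<Sum>i\<in>UNIV. m $ i / CARD('n))"
    unfolding det_eigendecomposition[OF E]
    by (intro arith_geom_mean) (auto simp: psd_mats_eigenvalues[OF E M])
  then show ?thesis
    by (simp add: trace_eigendecomposition[OF E] field_simps flip: sum_divide_distrib)
qed

text \<open>
  Writing \<open>R = transpose B ** B\<close> turns \<open>inner R W\<close> into the trace of the positive semidefinite matrix
  \<open>B ** W ** transpose B\<close>, whose determinant is \<open>det R * det W\<close>.
\<close>
lemma inner_ge_det:
  fixes R W :: "real ^ 'n ^ 'n"
  assumes R: "R \<in> psd_mats" and W: "W \<in> psd_mats"
  shows "CARD('n) * det R powr (1 / CARD('n)) * det W powr (1 / CARD('n)) \<le> inner R W"
proof -
  obtain U l where E: "eigendecomposition R U l"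
    using R symmetric_eigendecomposition by (auto simp: psd_mats_def)
  have l: "0 \<le> l $ i" for i by (rule psd_mats_eigenvalues[OF E R])
  let ?s = "\<chi> i. sqrt (l $ i)"
  define B where "B = Diag ?s ** transpose U"
  have "Diag ?s ** Diag ?s = Diag l" using l by (simp add: Diag_mult)
  then have RB: "R = transpose B ** B"
    using E by (simp add: B_def matrix_transpose_mul eigendecomposition_def)
      (metis matrix_mul_assoc)
  let ?M = "B ** W ** transpose B"
  have "?M \<in> sym_mats"
    using W by (simp add: psd_mats_def sym_mats_def matrix_transpose_mul matrix_mul_assoc)
  moreover have "0 \<le> inner x (?M *v x)" for x
  proof -
    have "inner x (?M *v x) = inner (transpose B *v x) (W *v (transpose B *v x))"
      by (simp add: inner_matrix_vector_transpose[of x B] flip: matrix_vector_mul_assoc)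
    then show ?thesis using W by (simp add: psd_mats_def)
  qed
  ultimately have M: "?M \<in> psd_mats" by (simp add: psd_mats_def)
  have "det ?M = det R * det W" by (simp add: RB det_mul)
  moreover have "transpose R = R" using R by (simp add: psd_mats_def sym_mats_def)
  then have "inner R W = trace (transpose B ** (B ** W))"
    by (simp only: inner_eq_trace RB matrix_mul_assoc)
  then have "trace ?M = inner R W"
    using trace_mul_sym[of "transpose B" "B ** W"] by simp
  ultimately show ?thesis
    using trace_ge_det[OF M] det_psd_nonneg[OF R] det_psd_nonneg[OF W]
    by (simp add: powr_mult mult.assoc)
qed

lemma det_scaleR:
  fixes W :: "real ^ 'n ^ 'n"
  shows "det (c *\<^sub>R W) = c ^ CARD('n) * det W"
  by (simp add: det_def prod.distrib sum_distrib_left mult_ac)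

lemma differentiable_powr_const:
  fixes f :: "'a::real_normed_vector \<Rightarrow> real"
  assumes "f differentiable (at x within S)" "0 < f x"
  shows "(\<lambda>x. f x powr a) differentiable (at x within S)"
proof -
  have "(\<lambda>t::real. t powr a) differentiable (at (f x))"
    using has_real_derivative_powr[OF assms(2), of a]
    unfolding differentiable_def has_field_derivative_def by blast
  then show ?thesis using assms(1) by (rule differentiable_compose)
qed

lemma differentiable_prod_real:
  fixes f :: "'i \<Rightarrow> 'a::real_normed_vector \<Rightarrow> real"
  assumes "\<And>i. i \<in> I \<Longrightarrow> f i differentiable (at x within S)"
  shows "(\<lambda>x. \<Prod>i\<in>I. f i x) differentiable (at x within S)"
  using assms by (induction I rule: infinite_finite_induct) auto

text \<open>
  The determinant is a polynomial in the entries. Its derivative is never computed: the gradient of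
  the conjugate barrier comes from the maximizer.
\<close>
lemma differentiable_det:
  "(det :: real ^ 'n ^ 'n \<Rightarrow> real) differentiable (at W within S)"
proof -
  have entry: "(\<lambda>W :: real^'n^'n. W $ i $ j) differentiable (at W within S)" for i j
    by (intro bounded_linear_imp_differentiable bounded_linear_compose[OF bounded_linear_vec_nth]
        bounded_linear_vec_nth)
  have "(\<lambda>W :: real^'n^'n. \<Sum>p | p permutes UNIV. of_int (sign p) * (\<Prod>i\<in>UNIV. W $ i $ p i))
      differentiable (at W within S)"
    by (intro differentiable_sum differentiable_mult differentiable_const differentiable_prod_real
        entry ballI) simp
  then show ?thesis by (simp add: det_def[abs_def])
qed

section \<open>The hypograph geometric mean cone\<close>

lemma ln_geom_mean:
  fixes w :: "real ^ 'n"
  assumes "\<forall>i. 0 < w $ i"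
  shows "CARD('n) * ln (geom_mean w) = (\<Sum>i\<in>UNIV. ln (w $ i))"
proof -
  have "ln (geom_mean w) = (\<Sum>i\<in>UNIV. ln (w $ i powr (1 / CARD('n))))"
    unfolding geom_mean_def using assms by (intro ln_prod) (auto simp: less_imp_neq[symmetric])
  also have "\<dots> = (\<Sum>i\<in>UNIV. ln (w $ i)) / CARD('n)"
    using assms by (simp add: sum_divide_distrib)
  finally show ?thesis by simp
qed

lemma geom_mean_eq_powr_prod:
  fixes w :: "real ^ 'n"
  assumes "\<forall>i. 0 \<le> w $ i"
  shows "geom_mean w = (\<Prod>i\<in>UNIV. w $ i) powr (1 / CARD('n))"
  unfolding geom_mean_def using assms by (intro prod_powr_distrib[symmetric])

lemma geometric_mean_cone_hgeom:
  "geometric_mean_cone UNIV {w :: real ^ 'n. \<forall>i. 0 < w $ i} {w. \<forall>i. 0 \<le> w $ i}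
    geom_mean (\<chi> i. 1) (\<lambda>w. \<chi> i. inverse (w $ i)) CARD('n)"
proof
  show "openin (top_of_set UNIV) {w :: real ^ 'n. \<forall>i. 0 < w $ i}"
    by (simp add: Collect_all_eq open_INT open_Collect_less continuous_intros)
  show "r \<in> {w. \<forall>i. 0 \<le> w $ i}"
    if "\<And>w. w \<in> {w. \<forall>i. 0 \<le> w $ i} \<Longrightarrow> 0 \<le> inner r w" for r :: "real ^ 'n"
  proof clarify
    fix i
    have "0 \<le> inner r (axis i 1)" by (rule that) (simp add: axis_def)
    then show "0 \<le> r $ i" by (simp add: inner_axis)
  qed
  show "0 < geom_mean w" if "w \<in> {w :: real ^ 'n. \<forall>i. 0 < w $ i}" for w
    using that unfolding geom_mean_def by (intro prod_pos) (simp add: less_imp_neq[symmetric])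
  show "geom_mean (c *\<^sub>R w) = c * geom_mean w"
    if "0 < c" "w \<in> {w :: real ^ 'n. \<forall>i. 0 < w $ i}" for c w
    using that by (simp add: geom_mean_def powr_mult less_imp_le prod.distrib powr_power)
  show "geom_mean differentiable (at w within UNIV)"
    if "w \<in> {w :: real ^ 'n. \<forall>i. 0 < w $ i}" for w
    unfolding geom_mean_def using that
    by (intro differentiable_prod_real differentiable_powr_const bounded_linear_imp_differentiable
        bounded_linear_vec_nth) simp
  show "CARD('n) * geom_mean r * geom_mean w \<le> inner r w"
    if "r \<in> {w. \<forall>i. 0 < w $ i}" "w \<in> {w :: real ^ 'n. \<forall>i. 0 < w $ i}" for r w
  proof -
    have "geom_mean r * geom_mean w = (\<Prod>i\<in>UNIV. r $ i * w $ i) powr (1 / CARD('n))"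
      using that by (simp add: geom_mean_eq_powr_prod less_imp_le powr_mult prod_nonneg prod.distrib)
    also have "\<dots> \<le> (\<Sum>i\<in>UNIV. r $ i * w $ i / CARD('n))"
      using that by (intro arith_geom_mean) (auto simp: less_imp_le)
    also have "\<dots> = inner r w / CARD('n)" by (simp add: inner_vec_def sum_divide_distrib)
    finally show ?thesis by (simp add: field_simps)
  qed
  show "geom_mean (\<chi> i. inverse (r $ i)) = 1 / geom_mean r"
    if "r \<in> {w :: real ^ 'n. \<forall>i. 0 < w $ i}" for r
  proof -
    have "geom_mean (\<chi> i. inverse (r $ i)) * geom_mean r = 1"
      using that by (simp add: geom_mean_def less_imp_le less_imp_neq[symmetric]
          flip: prod.distrib powr_mult)
    then show ?thesis by (metis mult_zero_right nonzero_eq_divide_eq zero_neq_one)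
  qed
  show "inner r (\<chi> i. inverse (r $ i)) = CARD('n)"
    if "r \<in> {w :: real ^ 'n. \<forall>i. 0 < w $ i}" for r
    using that by (simp add: inner_vec_def less_imp_neq[symmetric])
qed (auto simp: less_imp_le geom_mean_def add_nonneg_pos intro!: prod_nonneg)

lemma hgeom_conj_gradient_eq:
  fixes r :: "real ^ 'n"
  assumes "p < 0" "\<forall>i. 0 < r $ i" "0 < geom_mean r + p / CARD('n)"
  shows "hgeom_conj_gradient (p, r) =
    (- inverse p - inverse (geom_mean r + p / CARD('n)),
     - (geom_mean r / (geom_mean r + p / CARD('n))) *\<^sub>R (\<chi> i. inverse (r $ i)))"
proof -
  interpret geometric_mean_cone UNIV "{w :: real ^ 'n. \<forall>i. 0 < w $ i}" "{w. \<forall>i. 0 \<le> w $ i}"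
    geom_mean "\<chi> i. 1" "\<lambda>w. \<chi> i. inverse (w $ i)" "CARD('n)"
    by (rule geometric_mean_cone_hgeom)
  have "conj_gradient (UNIV \<times> UNIV) hgeom_cone hgeom_barrier (p, r) =
    (- inverse p - inverse (geom_mean r + p / CARD('n)),
     - (geom_mean r / (geom_mean r + p / CARD('n))) *\<^sub>R (\<chi> i. inverse (r $ i)))"
  proof (rule conj_gradient_eq)
    show "(p, r) \<in> dual_interior" using assms by (simp add: dual_interior_def)
    show "hgeom_cone = cone" by (simp add: hgeom_cone_def cone_def)
    show "hgeom_barrier z = barrier z" if "z \<in> interior_in (UNIV \<times> UNIV) cone" for z
      using that ln_geom_mean[of "snd z"] unfolding interior_cone
      by (auto simp: hgeom_barrier_def barrier_def)
  qed
  then show ?thesis by (simp add: hgeom_conj_gradient_def)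
qed

section \<open>The root-determinant cone\<close>

lemma geom_mean_eigenvalues:
  fixes W :: "real ^ 'n ^ 'n"
  assumes "eigendecomposition W U l" "W \<in> psd_mats"
  shows "geom_mean l = det W powr (1 / CARD('n))"
  using psd_mats_eigenvalues[OF assms]
  by (simp add: geom_mean_eq_powr_prod det_eigendecomposition[OF assms(1)])

lemma geometric_mean_cone_rtdet:
  "geometric_mean_cone sym_mats (pd_mats :: (real ^ 'n ^ 'n) set) psd_mats
    (\<lambda>W. det W powr (1 / CARD('n))) (mat 1) matrix_inv CARD('n)"
proof
  show "W \<in> psd_mats"
    if "W \<in> sym_mats" "\<And>V. V \<in> psd_mats \<Longrightarrow> 0 \<le> inner W V" for W :: "real ^ 'n ^ 'n"
    using that(1) that(2)[OF outer_psd] by (simp add: psd_mats_def inner_outer)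
  show "W + \<epsilon> *\<^sub>R mat 1 \<in> pd_mats" if "W \<in> psd_mats" "0 < \<epsilon>" for W :: "real ^ 'n ^ 'n" and \<epsilon>
  proof -
    have "W + \<epsilon> *\<^sub>R mat 1 \<in> sym_mats"
      using that subspace_sym_mats
      by (intro subspace_add subspace_scale) (auto simp: psd_mats_def mat_1_sym)
    then show ?thesis using that
      by (simp add: pd_mats_def psd_mats_def matrix_vector_mult_add_rdistrib inner_add_right
          add_nonneg_pos flip: scaleR_matrix_vector_assoc)
  qed
  show "c *\<^sub>R W \<in> pd_mats" if "0 < c" "W \<in> pd_mats" for c and W :: "real ^ 'n ^ 'n"
    using that subspace_scale[OF subspace_sym_mats, of W c]
    by (simp add: pd_mats_def flip: scaleR_matrix_vector_assoc)
  show "det (c *\<^sub>R W) powr (1 / CARD('n)) = c * det W powr (1 / CARD('n))"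
    if "0 < c" "W \<in> pd_mats" for c and W :: "real ^ 'n ^ 'n"
    using that det_pd_pos[OF that(2)]
    by (simp add: det_scaleR powr_mult powr_powr flip: powr_realpow)
  show "(\<lambda>W. det W powr (1 / CARD('n))) differentiable (at W within sym_mats)"
    if "W \<in> pd_mats" for W :: "real ^ 'n ^ 'n"
    by (intro differentiable_powr_const differentiable_det det_pd_pos that)
  show "CARD('n) * det R powr (1 / CARD('n)) * det W powr (1 / CARD('n)) \<le> inner R W"
    if "R \<in> pd_mats" "W \<in> pd_mats" for R W :: "real ^ 'n ^ 'n"
    using that pd_mats_psd by (intro inner_ge_det) auto
  show "det (matrix_inv R) powr (1 / CARD('n)) = 1 / det R powr (1 / CARD('n))"
    if "R \<in> pd_mats" for R :: "real ^ 'n ^ 'n"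
  proof -
    have "det R * det (matrix_inv R) = 1"
      using matrix_inv_pd(1)[OF that] by (metis det_I det_mul)
    then have "det (matrix_inv R) = 1 / det R"
      using det_pd_pos[OF that] by (simp add: field_simps)
    then show ?thesis using det_pd_pos[OF that] by (simp add: powr_divide)
  qed
  show "inner R (matrix_inv R) = CARD('n)" if "R \<in> pd_mats" for R :: "real ^ 'n ^ 'n"
    using that matrix_inv_pd(1)[OF that]
    by (simp add: inner_eq_trace pd_mats_def sym_mats_def trace_I)
  show "0 < det W powr (1 / CARD('n))" if "W \<in> pd_mats" for W :: "real ^ 'n ^ 'n"
    using det_pd_pos[OF that] by simp
  show "openin (top_of_set sym_mats) (pd_mats :: (real ^ 'n ^ 'n) set)" by (rule openin_pd_mats)
qed (use subspace_sym_mats pd_mats_psd matrix_inv_pd(2) in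
    \<open>auto simp: psd_mats_def subspace_0[OF subspace_sym_mats] mat_1_sym\<close>)

text \<open>
  Whatever order of the eigenvalues \<open>eigenvalues W\<close> chooses, the barrier depends on their
  product only.
\<close>
lemma rtdet_barrier_eq:
  fixes W :: "real ^ 'n ^ 'n"
  assumes "W \<in> pd_mats"
  shows "rtdet_barrier (u, W) =
    - ln (det W powr (1 / CARD('n)) - u) - CARD('n) * ln (det W powr (1 / CARD('n)))"
proof -
  have psd: "W \<in> psd_mats" using assms pd_mats_psd by blast
  obtain U l where "eigendecomposition W U l"
    using assms symmetric_eigendecomposition by (auto simp: pd_mats_def)
  then have "\<exists>l U. eigendecomposition W U l" by blast
  from someI_ex[OF this] obtain U where E: "eigendecomposition W U (eigenvalues W)"
    unfolding eigenvalues_def by blast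
  have "\<forall>i. 0 < eigenvalues W $ i" using assms pd_mats_iff_eigenvalues[OF E] by simp
  from ln_geom_mean[OF this] show ?thesis
    by (simp only: rtdet_barrier_def hgeom_barrier_def prod.case geom_mean_eigenvalues[OF E psd])
qed

theorem proposition3p4:
  fixes p :: real and R U :: "real ^ 'n ^ 'n" and l :: "real ^ 'n"
  assumes "(p, R) \<in> interior_in rtdet_space (dual_cone rtdet_space rtdet_cone)"
    and "eigendecomposition R U l"
  shows "fst (rtdet_conj_gradient (p, R)) = fst (hgeom_conj_gradient (p, l))
    \<and> fst (hgeom_conj_gradient (p, l)) =
        - inverse p - inverse (det R powr (1 / real CARD('n)) + p / real CARD('n))
    \<and> snd (rtdet_conj_gradient (p, R)) =
        U ** Diag (snd (hgeom_conj_gradient (p, l))) ** transpose U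
    \<and> U ** Diag (snd (hgeom_conj_gradient (p, l))) ** transpose U =
        - (det R powr (1 / real CARD('n)) /
            (det R powr (1 / real CARD('n)) + p / real CARD('n))) *\<^sub>R matrix_inv R"
proof -
  let ?\<phi> = "\<lambda>W :: real ^ 'n ^ 'n. det W powr (1 / real CARD('n))"
  interpret geometric_mean_cone sym_mats "pd_mats :: (real ^ 'n ^ 'n) set" psd_mats
    ?\<phi> "mat 1" matrix_inv "CARD('n)"
    by (rule geometric_mean_cone_rtdet)
  have cone: "rtdet_cone = cone" by (simp add: rtdet_cone_def cone_def)
  have s: "(p, R) \<in> dual_interior"
    using assms(1) interior_dual_cone_subset by (auto simp: cone rtdet_space_def)
  then have p: "p < 0" and R: "R \<in> pd_mats" and b: "0 < ?\<phi> R + p / CARD('n)"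
    by (auto simp: dual_interior_def)
  have rtdet: "rtdet_conj_gradient (p, R) =
    (- inverse p - inverse (?\<phi> R + p / CARD('n)), - (?\<phi> R / (?\<phi> R + p / CARD('n))) *\<^sub>R matrix_inv R)"
    unfolding rtdet_conj_gradient_def rtdet_space_def
  proof (rule conj_gradient_eq[OF s cone])
    show "rtdet_barrier z = barrier z" if "z \<in> interior_in (UNIV \<times> sym_mats) cone" for z
      using that unfolding interior_cone by (auto simp: barrier_def rtdet_barrier_eq)
  qed
  have l: "\<forall>i. 0 < l $ i" using R pd_mats_iff_eigenvalues[OF assms(2)] by simp
  have mean: "geom_mean l = ?\<phi> R"
    using geom_mean_eigenvalues[OF assms(2)] R pd_mats_psd by blast
  have hgeom: "hgeom_conj_gradient (p, l) =
    (- inverse p - inverse (?\<phi> R + p / CARD('n)),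
     - (?\<phi> R / (?\<phi> R + p / CARD('n))) *\<^sub>R (\<chi> i. inverse (l $ i)))"
    using hgeom_conj_gradient_eq[OF p l] b by (simp add: mean)
  have "eigendecomposition (matrix_inv R) U (\<chi> i. inverse (l $ i))"
    using l by (intro matrix_inv_eigendecomposition(2)[OF assms(2)]) (metis less_irrefl)
  then have "U ** Diag (c *\<^sub>R (\<chi> i. inverse (l $ i))) ** transpose U = c *\<^sub>R matrix_inv R" for c
    by (simp only: eigendecomposition_def Diag_scaleR scaleR_conjugate)
  then show ?thesis by (simp only: rtdet hgeom fst_conv snd_conv simp_thms)
qed

end
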